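(* Consider, for step sets $X\subseteq\mathbb{Z}^2\setminus\{O\}$, the following seven implications between properties of $X$: $$\mathrm{CC}\Rightarrow\mathrm{SLC},\quad \mathrm{SLC}\Rightarrow\mathrm{LC},\quad \mathrm{FPP}\Rightarrow\mathrm{BPP},\quad \mathrm{BPP}\Rightarrow\neg\mathrm{IPP},\quad \mathrm{CC}\Rightarrow\mathrm{FPP},\quad \mathrm{SLC}\Rightarrow\mathrm{BPP},\quad \mathrm{LC}\Rightarrow\neg\mathrm{IPP}.$$ (i) All seven implications hold for an arbitrary step set $X\subseteq\mathbb{Z}^2\setminus\{O\}$. (ii) For an arbitrary finite step set $X\subseteq\mathbb{Z}^2\setminus\{O\}$, all seven implications are reversible; that is, the six conditions CC, SLC, LC, FPP, BPP and $\neg$IPP are equivalent for $X$. (iii) In general, none of the seven implications is reversible; that is, for each of the seven implications $P\Rightarrow Q$ there is a step set $X\subseteq\mathbb{Z}^2\setminus\{O\}$ satisfying $Q$ but not $P$.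
   Context: Write $O=(0,0)$ and $\mathbb{N}=\{0,1,2,\ldots\}$. A step set is any subset $X$ of $\mathbb{Z}^2\setminus\{O\}$ (finite or infinite). $\mathcal{F}_X$ is the free monoid on $X$: all words $A_1\cdots A_k$ ($k\in\mathbb{N}$, $A_i\in X$), including the empty word; the length of $w=A_1\cdots A_k$ is $\ell(w)=k$. $\mathcal{A}_X$ is the additive submonoid of $\mathbb{Z}^2$ generated by $X$, and $\alpha_X(A_1\cdots A_k)=A_1+\cdots+A_k$. For $A\in\mathbb{Z}^2$ let $\Pi_X(A)=\{w\in\mathcal{F}_X:\alpha_X(w)=A\}$ and $\pi_X(A)=|\Pi_X(A)|\in\mathbb{N}\cup\{\infty\}$. Finiteness properties: $X$ has the FPP (Finite Paths Property) if $\pi_X(A)<\infty$ for all $A\in\mathcal{A}_X$; the IPP (Infinite Paths Property) if $\pi_X(A)=\infty$ for all $A\in\mathcal{A}_X$; the BPP (Bounded Paths Property) if for every $A\in\mathcal{A}_X$ the set $\{\ell(w):w\in\Pi_X(A)\}$ is finite (has a maximum). $\neg$IPP means that $X$ does not have the IPP. Geometric conditions: a line splits $\mathbb{R}^2$ into two open half-planes, which are opposites of each other. A cone is an intersection of two open half-planes whose bounding lines are not parallel; its vertex is the intersection point of these lines. $X$ satisfies the LC (Line Condition) if it is contained in an open half-plane bounded by a line through $O$; the SLC (Strong Line Condition) if it is contained in an open half-plane whose opposite open half-plane contains $O$; the CC (Cone Condition) if it is contained in a cone with vertex $O$. *)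

theory Defs
  imports "HOL-Analysis.Analysis" "HOL-Library.Extended_Nat"
begin

type_synonym point = "int \<times> int"

definition step_set :: "point set \<Rightarrow> bool" where
  "step_set X \<longleftrightarrow> 0 \<notin> X"

text \<open>The free monoid on \<open>X\<close> is \<^term>\<open>lists X\<close>, with word length \<^const>\<open>length\<close>;
  the evaluation homomorphism to the lattice is \<^const>\<open>sum_list\<close>.\<close>

inductive_set submonoid_gen :: "point set \<Rightarrow> point set" for X :: "point set" where
  zero: "0 \<in> submonoid_gen X"
| gen: "A \<in> X \<Longrightarrow> A \<in> submonoid_gen X"
| add: "A \<in> submonoid_gen X \<Longrightarrow> B \<in> submonoid_gen X \<Longrightarrow> A + B \<in> submonoid_gen X"

definition paths :: "point set \<Rightarrow> point \<Rightarrow> point list set" where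
  "paths X A = {w \<in> lists X. sum_list w = A}"

definition path_count :: "point set \<Rightarrow> point \<Rightarrow> enat" where
  "path_count X A = (if finite (paths X A) then enat (card (paths X A)) else \<infinity>)"

definition FPP :: "point set \<Rightarrow> bool" where
  "FPP X \<longleftrightarrow> (\<forall>A \<in> submonoid_gen X. path_count X A < \<infinity>)"

definition IPP :: "point set \<Rightarrow> bool" where
  "IPP X \<longleftrightarrow> (\<forall>A \<in> submonoid_gen X. path_count X A = \<infinity>)"

definition BPP :: "point set \<Rightarrow> bool" where
  "BPP X \<longleftrightarrow> (\<forall>A \<in> submonoid_gen X. finite (length ` paths X A))"

definition to_plane :: "point \<Rightarrow> real \<times> real" where
  "to_plane A = (real_of_int (fst A), real_of_int (snd A))"

text \<open>For \<open>a \<noteq> 0\<close>, \<open>bd_line a c\<close> ranges over all lines of the plane, and \<open>half_plane a c\<close> and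
  \<open>opp_half_plane a c\<close> are the two open half-planes it bounds. Either side of a line
  can play the role of \<open>half_plane\<close>, by passing to \<open>(- a, - c)\<close>.\<close>

definition bd_line :: "real \<times> real \<Rightarrow> real \<Rightarrow> (real \<times> real) set" where
  "bd_line a c = {x. a \<bullet> x = c}"

definition half_plane :: "real \<times> real \<Rightarrow> real \<Rightarrow> (real \<times> real) set" where
  "half_plane a c = {x. a \<bullet> x > c}"

definition opp_half_plane :: "real \<times> real \<Rightarrow> real \<Rightarrow> (real \<times> real) set" where
  "opp_half_plane a c = {x. a \<bullet> x < c}"

text \<open>In particular, every line is parallel to itself.\<close>

definition parallel_lines :: "(real \<times> real) set \<Rightarrow> (real \<times> real) set \<Rightarrow> bool" where
  "parallel_lines L M \<longleftrightarrow> (\<exists>t. M = (\<lambda>x. t + x) ` L)"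

definition cone_with_vertex :: "(real \<times> real) set \<Rightarrow> real \<times> real \<Rightarrow> bool" where
  "cone_with_vertex C v \<longleftrightarrow>
    (\<exists>a c b d. a \<noteq> 0 \<and> b \<noteq> 0 \<and> \<not> parallel_lines (bd_line a c) (bd_line b d) \<and>
       C = half_plane a c \<inter> half_plane b d \<and> bd_line a c \<inter> bd_line b d = {v})"

definition LC :: "point set \<Rightarrow> bool" where
  "LC X \<longleftrightarrow> (\<exists>a c. a \<noteq> 0 \<and> 0 \<in> bd_line a c \<and> to_plane ` X \<subseteq> half_plane a c)"

definition SLC :: "point set \<Rightarrow> bool" where
  "SLC X \<longleftrightarrow> (\<exists>a c. a \<noteq> 0 \<and> to_plane ` X \<subseteq> half_plane a c \<and> 0 \<in> opp_half_plane a c)"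

definition CC :: "point set \<Rightarrow> bool" where
  "CC X \<longleftrightarrow> (\<exists>C. cone_with_vertex C 0 \<and> to_plane ` X \<subseteq> C)"

end

theory Submission
  imports Defs
begin

text \<open>The IPP fails exactly when no nonempty word over \<open>X\<close> has sum \<open>0\<close>, because a zero-sum word can
  be prepended to any path arbitrarily often. The geometric conditions bound lengths and steps of
  paths by means of linear functionals that are positive on \<open>X\<close>. If \<open>X\<close> is finite and has no
  zero-sum word, then it has a clockwise-most step \<open>p\<close>, and the functionals
  \<open>x \<mapsto> n cross(p, x) + p \<bullet> x\<close> for two large values of \<open>n\<close> bound a cone containing \<open>X\<close>.
  Three step sets separate the conditions: a vertical line, the parabola
  \<open>(n, - n\<^sup>2)\<close> for \<open>n \<ge> 1\<close> together with \<open>(0, 1)\<close> (which has the FPP but not the LC), and all lattice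
  points in an open half-plane with irrational boundary (which has the LC but not the BPP).\<close>

section \<open>Linear functionals evaluated along words\<close>

lemma inner_to_plane: "a \<bullet> to_plane x = fst a * of_int (fst x) + snd a * of_int (snd x)"
  by (simp add: to_plane_def inner_prod_def)

lemma inner_to_plane_sum_list:
  "a \<bullet> to_plane (sum_list w) = (\<Sum>x\<leftarrow>w. a \<bullet> to_plane x)"
  by (induction w) (auto simp: inner_to_plane algebra_simps)

text \<open>Turns a positive lower bound on the steps into a length bound for all paths to a fixed
  point.\<close>

lemma length_le_inner_sum_list:
  assumes "\<And>x. x \<in> set w \<Longrightarrow> \<delta> \<le> a \<bullet> to_plane x"
  shows "of_nat (length w) * \<delta> \<le> a \<bullet> to_plane (sum_list w)"
  using assms unfolding inner_to_plane_sum_list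
  by (induction w) (fastforce simp: algebra_simps)+

lemma inner_step_le_inner_sum_list:
  assumes "\<And>y. y \<in> set w \<Longrightarrow> 0 \<le> a \<bullet> to_plane y" and "x \<in> set w"
  shows "a \<bullet> to_plane x \<le> a \<bullet> to_plane (sum_list w)"
  unfolding inner_to_plane_sum_list
  by (rule member_le_sum_list) (use assms in auto)

lemma sum_list_replicate_point:
  "sum_list (replicate n (x::point)) = (int n * fst x, int n * snd x)"
  by (induction n) (auto simp: algebra_simps prod_eq_iff)

lemma submonoid_gen_eq: "submonoid_gen X = sum_list ` lists X"
proof (intro equalityI subsetI)
  fix A assume "A \<in> submonoid_gen X"
  then show "A \<in> sum_list ` lists X"
  proof induction
    case zero
    show ?case by (intro image_eqI[of _ _ "[]"]) auto
  next
    case (gen A)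
    then show ?case by (intro image_eqI[of _ _ "[A]"]) auto
  next
    case (add A B)
    then obtain v w where "v \<in> lists X" "w \<in> lists X" "A = sum_list v" "B = sum_list w"
      by auto
    then show ?case by (intro image_eqI[of _ _ "v @ w"]) auto
  qed
next
  have "sum_list w \<in> submonoid_gen X" if "w \<in> lists X" for w
    using that by (induction w) (auto intro: submonoid_gen.intros)
  then show "A \<in> submonoid_gen X" if "A \<in> sum_list ` lists X" for A
    using that by auto
qed

lemma path_count_less_top_iff: "path_count X A < \<infinity> \<longleftrightarrow> finite (paths X A)"
  by (simp add: path_count_def)

section \<open>Zero-sum words\<close>

text \<open>Copies of \<open>w\<close> in front of \<open>v\<close> keep the sum and lengthen the
  word. Counting lengths rather than words lets the same argument refute the BPP.\<close>

lemma infinite_lengths_if_zero_sum: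
  assumes "w \<in> lists X" "w \<noteq> []" "sum_list w = 0" and "A \<in> submonoid_gen X"
  shows "infinite (length ` paths X A)"
proof -
  obtain v where v: "v \<in> lists X" "A = sum_list v"
    using assms(4) by (auto simp: submonoid_gen_eq)
  let ?f = "\<lambda>n. concat (replicate n w) @ v"
  have "sum_list (concat (replicate n w)) = 0" for n
    by (induction n) (auto simp: assms(3))
  then have "?f n \<in> paths X A" for n
    using v assms(1) by (auto simp: paths_def)
  then have "length (?f n) \<in> length ` paths X A" for n
    by (intro imageI)
  then have "range (\<lambda>n. length (?f n)) \<subseteq> length ` paths X A"
    by blast
  moreover have "length (?f n) = n * length w + length v" for n
    by (induction n) auto
  then have "inj (\<lambda>n. length (?f n))"
    using assms(2) by (auto intro!: injI)
  ultimately show ?thesis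
    using range_inj_infinite finite_subset by blast
qed

lemma not_IPP_iff: "\<not> IPP X \<longleftrightarrow> (\<forall>w\<in>lists X. sum_list w = 0 \<longrightarrow> w = [])"
proof
  assume "\<not> IPP X"
  then obtain A where "A \<in> submonoid_gen X" "finite (paths X A)"
    by (auto simp: IPP_def path_count_def split: if_splits)
  then show "\<forall>w\<in>lists X. sum_list w = 0 \<longrightarrow> w = []"
    using infinite_lengths_if_zero_sum by blast
next
  assume *: "\<forall>w\<in>lists X. sum_list w = 0 \<longrightarrow> w = []"
  have "paths X 0 = {[]}"
    using * unfolding paths_def by auto
  then have "path_count X 0 \<noteq> \<infinity>"
    by (simp add: path_count_def)
  then show "\<not> IPP X"
    unfolding IPP_def using submonoid_gen.zero by (metis (lifting))
qed

lemma FPP_imp_BPP: "FPP X \<Longrightarrow> BPP X"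
  unfolding FPP_def BPP_def path_count_less_top_iff by blast

lemma BPP_imp_not_IPP: "BPP X \<Longrightarrow> \<not> IPP X"
  unfolding not_IPP_iff BPP_def
  using infinite_lengths_if_zero_sum submonoid_gen.zero by blast

section \<open>The geometric conditions\<close>

lemma LC_iff: "LC X \<longleftrightarrow> (\<exists>a. a \<noteq> 0 \<and> (\<forall>x\<in>X. 0 < a \<bullet> to_plane x))"
proof -
  have "0 \<in> bd_line a c \<and> to_plane ` X \<subseteq> half_plane a c \<longleftrightarrow>
      c = 0 \<and> (\<forall>x\<in>X. 0 < a \<bullet> to_plane x)" for a c
    by (auto simp: bd_line_def half_plane_def)
  then show ?thesis
    unfolding LC_def by blast
qed

lemma SLC_iff: "SLC X \<longleftrightarrow> (\<exists>a c. a \<noteq> 0 \<and> 0 < c \<and> (\<forall>x\<in>X. c < a \<bullet> to_plane x))"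
proof -
  have "to_plane ` X \<subseteq> half_plane a c \<and> 0 \<in> opp_half_plane a c \<longleftrightarrow>
      0 < c \<and> (\<forall>x\<in>X. c < a \<bullet> to_plane x)" for a c
    by (auto simp: opp_half_plane_def half_plane_def)
  then show ?thesis
    unfolding SLC_def by simp
qed

text \<open>The vertex \<open>0\<close> lies on both boundary lines, which forces
  \<open>c = d = 0\<close>; lines through the origin are non-parallel exactly when their normals
  have nonzero determinant.\<close>

lemma CC_iff:
  "CC X \<longleftrightarrow> (\<exists>a b. fst a * snd b \<noteq> snd a * fst b \<and>
     (\<forall>x\<in>X. 0 < a \<bullet> to_plane x \<and> 0 < b \<bullet> to_plane x))" (is "_ \<longleftrightarrow> ?R")
proof
  assume "CC X"
  then obtain a c b d where ab: "a \<noteq> 0" "b \<noteq> 0" "bd_line a c \<inter> bd_line b d = {0}"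
    and X: "to_plane ` X \<subseteq> half_plane a c \<inter> half_plane b d"
    unfolding CC_def cone_with_vertex_def by metis
  have "0 \<in> bd_line a c \<inter> bd_line b d"
    using ab by simp
  then have cd: "c = 0" "d = 0"
    by (auto simp: bd_line_def)
  have "fst a * snd b \<noteq> snd a * fst b"
  proof
    assume "fst a * snd b = snd a * fst b"
    \<comment> \<open>The direction vector of the first line would be a second common point.\<close>
    then have "(- snd a, fst a) \<in> bd_line a c \<inter> bd_line b d"
      by (auto simp: bd_line_def inner_prod_def cd algebra_simps)
    then show False
      using ab by (auto simp: prod_eq_iff)
  qed
  moreover have "\<forall>x\<in>X. 0 < a \<bullet> to_plane x \<and> 0 < b \<bullet> to_plane x"
    using X cd by (auto simp: half_plane_def)
  ultimately show ?R
    by blast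
next
  assume ?R
  then obtain a b where det: "fst a * snd b \<noteq> snd a * fst b"
    and X: "\<forall>x\<in>X. 0 < a \<bullet> to_plane x \<and> 0 < b \<bullet> to_plane x" by blast
  have "\<not> parallel_lines (bd_line a 0) (bd_line b 0)"
  proof
    assume "parallel_lines (bd_line a 0) (bd_line b 0)"
    then obtain t where t: "bd_line b 0 = (\<lambda>x. t + x) ` bd_line a 0"
      by (auto simp: parallel_lines_def)
    have "t + x \<in> bd_line b 0" if "x \<in> bd_line a 0" for x
      using that t by blast
    \<comment> \<open>The translated direction vector and \<open>t\<close> both lie on the second
      line, so their difference is orthogonal to \<open>b\<close>.\<close>
    from this[of 0] this[of "(- snd a, fst a)"]
    have "b \<bullet> t = 0" "b \<bullet> (t + (- snd a, fst a)) = 0"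
      by (auto simp: bd_line_def inner_prod_def)
    then have "b \<bullet> (- snd a, fst a) = 0"
      by (simp add: inner_add_right)
    then show False
      using det by (simp add: inner_prod_def algebra_simps)
  qed
  moreover have "x = 0" if "x \<in> bd_line a 0 \<inter> bd_line b 0" for x
  proof -
    have h: "fst a * fst x + snd a * snd x = 0" "fst b * fst x + snd b * snd x = 0"
      using that by (auto simp: bd_line_def inner_prod_def)
    have "(fst a * snd b - snd a * fst b) * fst x = 0" "(fst a * snd b - snd a * fst b) * snd x = 0"
      using h by algebra+
    then show ?thesis
      using det by (auto simp: prod_eq_iff)
  qed
  then have "bd_line a 0 \<inter> bd_line b 0 = {0}"
    by (auto simp: bd_line_def)
  moreover have "a \<noteq> 0" "b \<noteq> 0"
    using det by auto
  ultimately have "cone_with_vertex (half_plane a 0 \<inter> half_plane b 0) 0"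
    unfolding cone_with_vertex_def by blast
  then show "CC X"
    unfolding CC_def using X by (auto simp: half_plane_def)
qed

text \<open>If \<open>a\<close> and \<open>b\<close> define the cone, then by Cramer's rule \<open>a + b\<close> dominates both coordinates
  on it.\<close>

lemma CC_coercive:
  assumes "CC X"
  shows "\<exists>a K. a \<noteq> 0 \<and> 0 < K \<and> (\<forall>x\<in>X. \<bar>of_int (fst x)\<bar> \<le> K * (a \<bullet> to_plane x) \<and>
    \<bar>of_int (snd x)\<bar> \<le> K * (a \<bullet> to_plane x))"
proof -
  obtain a b where det: "fst a * snd b \<noteq> snd a * fst b"
    and X: "\<And>x. x \<in> X \<Longrightarrow> 0 < a \<bullet> to_plane x \<and> 0 < b \<bullet> to_plane x"
    using assms unfolding CC_iff by blast
  define D where "D = fst a * snd b - snd a * fst b"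
  \<comment> \<open>\<open>M\<close> dominates all entries of \<open>a\<close> and \<open>b\<close>,
    hence every coefficient in Cramer's rule.\<close>
  define M where "M = \<bar>fst a\<bar> + \<bar>snd a\<bar> + \<bar>fst b\<bar> + \<bar>snd b\<bar>"
  have D: "D \<noteq> 0"
    using det by (simp add: D_def)
  have M: "0 < M"
  proof (rule ccontr)
    assume "\<not> 0 < M"
    then have "fst a = 0" "snd a = 0"
      unfolding M_def by linarith+
    then show False
      using det by simp
  qed
  have bound: "\<bar>p * u - q * v\<bar> \<le> M * (v + u)"
    if "\<bar>p\<bar> \<le> M" "\<bar>q\<bar> \<le> M" "0 < u" "0 < v" for p q u v :: real
  proof -
    have "\<bar>p * u - q * v\<bar> \<le> \<bar>p\<bar> * u + \<bar>q\<bar> * v"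
      using that abs_triangle_ineq4[of "p * u" "q * v"] by (simp add: abs_mult)
    also have "\<dots> \<le> M * u + M * v"
      using that by (intro add_mono mult_right_mono) auto
    finally show ?thesis by (simp add: algebra_simps)
  qed
  have "\<bar>D * of_int (fst x)\<bar> \<le> M * ((a + b) \<bullet> to_plane x) \<and>
        \<bar>D * of_int (snd x)\<bar> \<le> M * ((a + b) \<bullet> to_plane x)" if "x \<in> X" for x
  proof -
    have "D * of_int (fst x) = snd b * (a \<bullet> to_plane x) - snd a * (b \<bullet> to_plane x)"
      "D * of_int (snd x) = fst a * (b \<bullet> to_plane x) - fst b * (a \<bullet> to_plane x)"
      by (auto simp: D_def inner_to_plane algebra_simps)
    then show ?thesis
      using bound[of "snd b" "snd a" "a \<bullet> to_plane x" "b \<bullet> to_plane x"]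
        bound[of "fst a" "fst b" "b \<bullet> to_plane x" "a \<bullet> to_plane x"] X[OF that]
      by (auto simp: M_def inner_add_left add.commute)
  qed
  then have "\<bar>of_int (fst x)\<bar> \<le> M / \<bar>D\<bar> * ((a + b) \<bullet> to_plane x)"
    "\<bar>of_int (snd x)\<bar> \<le> M / \<bar>D\<bar> * ((a + b) \<bullet> to_plane x)" if "x \<in> X" for x
    using that D by (auto simp: field_simps abs_mult)
  moreover have "a + b \<noteq> 0"
    using det by (auto simp: add_eq_0_iff2)
  moreover have "0 < M / \<bar>D\<bar>"
    using M D by simp
  ultimately show ?thesis
    by blast
qed

text \<open>Discreteness of the lattice: a nonzero point has a coordinate of absolute value at least
  \<open>1\<close>.\<close>

lemma coercive_bounded_below:
  assumes "x \<noteq> (0::point)" "0 < K"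
    "\<bar>of_int (fst x)\<bar> \<le> K * (a \<bullet> to_plane x)" "\<bar>of_int (snd x)\<bar> \<le> K * (a \<bullet> to_plane x)"
  shows "1 / K \<le> a \<bullet> to_plane x"
proof -
  have "1 \<le> \<bar>fst x\<bar> \<or> 1 \<le> \<bar>snd x\<bar>"
    using assms(1) by (auto simp: prod_eq_iff)
  then have "1 \<le> \<bar>real_of_int (fst x)\<bar> \<or> 1 \<le> \<bar>real_of_int (snd x)\<bar>"
    by linarith
  then have "1 \<le> K * (a \<bullet> to_plane x)"
    using assms(3,4) by linarith
  then show ?thesis
    using assms(2) by (simp add: field_simps)
qed

section \<open>From geometric conditions to finiteness properties\<close>

lemma CC_imp_SLC:
  assumes "step_set X" "CC X"
  shows "SLC X"
proof -
  obtain a K where a: "a \<noteq> 0" and K: "0 < K"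
    and le: "\<And>x. x \<in> X \<Longrightarrow> \<bar>of_int (fst x)\<bar> \<le> K * (a \<bullet> to_plane x)"
      "\<And>x. x \<in> X \<Longrightarrow> \<bar>of_int (snd x)\<bar> \<le> K * (a \<bullet> to_plane x)"
    using CC_coercive[OF assms(2)] by blast
  have "1 / K \<le> a \<bullet> to_plane x" if "x \<in> X" for x
    using coercive_bounded_below[of x K a] le[OF that] K that assms(1)
    by (auto simp: step_set_def)
  \<comment> \<open>The bound is halved because the SLC asks for a strict inequality.\<close>
  moreover have "1 / (2 * K) < 1 / K" "0 < 1 / (2 * K)"
    using K by (auto simp: field_simps)
  ultimately show ?thesis
    unfolding SLC_iff using a by (meson less_le_trans)
qed

lemma SLC_imp_LC: "SLC X \<Longrightarrow> LC X"
  unfolding SLC_iff LC_iff by (meson less_trans)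

text \<open>Finitely many letters and bounded length leave finitely many words. \<open>F\<close> and
  the functional may depend on \<open>A\<close>, as the parabola requires: no functional is positive
  on all its steps.\<close>

lemma finite_paths_if:
  assumes "finite F" "\<And>w. w \<in> paths X A \<Longrightarrow> set w \<subseteq> F"
    and "0 < \<delta>" "\<And>x. x \<in> F \<inter> X \<Longrightarrow> \<delta> \<le> a \<bullet> to_plane x"
  shows "finite (paths X A)"
proof (rule finite_subset)
  show "paths X A \<subseteq> {w. set w \<subseteq> F \<and> length w \<le> nat \<lfloor>(a \<bullet> to_plane A) / \<delta>\<rfloor>}"
  proof
    fix w assume w: "w \<in> paths X A"
    then have "of_nat (length w) * \<delta> \<le> a \<bullet> to_plane A"
      using length_le_inner_sum_list[of w \<delta> a] assms(2)[OF w] assms(4)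
      by (auto simp: paths_def in_lists_conv_set)
    then have "of_nat (length w) \<le> (a \<bullet> to_plane A) / \<delta>"
      using assms(3) by (simp add: field_simps)
    then show "w \<in> {w. set w \<subseteq> F \<and> length w \<le> nat \<lfloor>(a \<bullet> to_plane A) / \<delta>\<rfloor>}"
      using assms(2)[OF w] by (simp add: le_nat_floor)
  qed
  show "finite {w. set w \<subseteq> F \<and> length w \<le> nat \<lfloor>(a \<bullet> to_plane A) / \<delta>\<rfloor>}"
    by (rule finite_lists_length_le[OF assms(1)])
qed

lemma CC_imp_FPP:
  assumes "step_set X" "CC X"
  shows "FPP X"
  unfolding FPP_def path_count_less_top_iff
proof
  fix A
  obtain a K where "a \<noteq> 0" and K: "0 < K"
    and le: "\<And>x. x \<in> X \<Longrightarrow> \<bar>of_int (fst x)\<bar> \<le> K * (a \<bullet> to_plane x)"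
      "\<And>x. x \<in> X \<Longrightarrow> \<bar>of_int (snd x)\<bar> \<le> K * (a \<bullet> to_plane x)"
    using CC_coercive[OF assms(2)] by blast
  have ge: "1 / K \<le> a \<bullet> to_plane x" if "x \<in> X" for x
    using coercive_bounded_below[of x K a] le[OF that] K that assms(1)
    by (auto simp: step_set_def)
  \<comment> \<open>Coercivity and monotonicity along a path bound the coordinates of each step by
    \<open>K * (a \<bullet> to_plane A)\<close>, so all steps lie in a finite box.\<close>
  define N where "N = \<lfloor>K * (a \<bullet> to_plane A)\<rfloor>"
  show "finite (paths X A)"
  proof (rule finite_paths_if)
    show "finite ({-N..N} \<times> {-N..N})"
      by simp
    show "set w \<subseteq> {-N..N} \<times> {-N..N}" if w: "w \<in> paths X A" for w
    proof
      fix x assume x: "x \<in> set w"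
      have wX: "set w \<subseteq> X" "sum_list w = A"
        using w by (auto simp: paths_def)
      have "0 \<le> a \<bullet> to_plane y" if "y \<in> set w" for y
        using ge[of y] that wX K by (meson order_trans less_imp_le divide_pos_pos zero_less_one subsetD)
      then have "a \<bullet> to_plane x \<le> a \<bullet> to_plane A"
        using inner_step_le_inner_sum_list[of w a x] x wX by blast
      then have "K * (a \<bullet> to_plane x) \<le> K * (a \<bullet> to_plane A)"
        using K by simp
      then have "of_int \<bar>fst x\<bar> \<le> K * (a \<bullet> to_plane A)" "of_int \<bar>snd x\<bar> \<le> K * (a \<bullet> to_plane A)"
        using le[of x] x wX by force+
      then have "\<bar>fst x\<bar> \<le> N" "\<bar>snd x\<bar> \<le> N"
        unfolding N_def le_floor_iff by auto
      then show "x \<in> {-N..N} \<times> {-N..N}"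
        by (cases x) auto
    qed
    show "0 < 1 / K"
      using K by simp
  qed (use ge in auto)
qed

text \<open>Every step advances by more than \<open>c\<close> along \<open>a\<close>, which limits
  the length. Steps may still be unbounded along the boundary line, so the number of paths is not
  controlled.\<close>

lemma SLC_imp_BPP:
  assumes "SLC X"
  shows "BPP X"
  unfolding BPP_def
proof
  fix A
  obtain a c where c: "0 < c" "\<And>x. x \<in> X \<Longrightarrow> c < a \<bullet> to_plane x"
    using assms unfolding SLC_iff by blast
  have "length w \<le> nat \<lfloor>(a \<bullet> to_plane A) / c\<rfloor>" if "w \<in> paths X A" for w
  proof -
    have "of_nat (length w) * c \<le> a \<bullet> to_plane A"
      using length_le_inner_sum_list[of w c a] that c(2)
      by (fastforce simp: paths_def in_lists_conv_set)
    then have "of_nat (length w) \<le> (a \<bullet> to_plane A) / c"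
      using c(1) by (simp add: field_simps)
    then show ?thesis
      by (simp add: le_nat_floor)
  qed
  then show "finite (length ` paths X A)"
    by (intro finite_subset[OF _ finite_atMost]) auto
qed

text \<open>The first letter of a nonempty zero-sum word would have a positive value not exceeding
  the total \<open>0\<close>.\<close>

lemma LC_imp_not_IPP:
  assumes "LC X"
  shows "\<not> IPP X"
  unfolding not_IPP_iff
proof (intro ballI impI)
  obtain a where a: "\<And>x. x \<in> X \<Longrightarrow> 0 < a \<bullet> to_plane x"
    using assms unfolding LC_iff by blast
  fix w assume w: "w \<in> lists X" "sum_list w = 0"
  show "w = []"
  proof (rule ccontr)
    assume "w \<noteq> []"
    then have x: "hd w \<in> set w"
      by simp
    have "a \<bullet> to_plane (hd w) \<le> a \<bullet> to_plane (sum_list w)"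
      by (rule inner_step_le_inner_sum_list[OF _ x]) (use a w in \<open>auto simp: in_lists_conv_set less_imp_le\<close>)
    then show False
      using a[of "hd w"] x w by (auto simp: in_lists_conv_set inner_to_plane)
  qed
qed

section \<open>Finite step sets\<close>

text \<open>Positive when \<open>v\<close> lies counterclockwise of \<open>u\<close> by less than a
  half turn. Being integers, such values can serve as multiplicities of letters.\<close>

abbreviation cross :: "point \<Rightarrow> point \<Rightarrow> int" where
  "cross u v \<equiv> fst u * snd v - snd u * fst v"

abbreviation dot :: "point \<Rightarrow> point \<Rightarrow> int" where
  "dot u v \<equiv> fst u * fst v + snd u * snd v"

text \<open>A relation with nonnegative integer coefficients is realized by a word with that many
  copies of each step; \<open>0 < i\<close> makes it nonempty.\<close>

lemma no_zero_sum_three: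
  assumes "\<not> IPP X" "u \<in> X" "v \<in> X" "w \<in> X" "0 < i" "0 \<le> j" "0 \<le> k"
    and "i * fst u + j * fst v + k * fst w = 0" "i * snd u + j * snd v + k * snd w = 0"
  shows False
proof -
  let ?w = "replicate (nat i) u @ replicate (nat j) v @ replicate (nat k) w"
  have "?w \<in> lists X" "sum_list ?w = 0" "?w \<noteq> []"
    using assms by (auto simp: sum_list_replicate_point prod_eq_iff)
  then show False
    using assms(1) unfolding not_IPP_iff by blast
qed

text \<open>For parallel steps \<open>dot u u * v = dot u v * u\<close>, a nonnegative relation if
  \<open>dot u v \<le> 0\<close>. The third step is a filler with coefficient
  \<open>0\<close>.\<close>

lemma no_opposite_steps:
  assumes "\<not> IPP X" "u \<in> X" "u \<noteq> 0" "v \<in> X" "cross u v = 0"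
  shows "0 < dot u v"
proof (rule ccontr)
  assume "\<not> 0 < dot u v"
  moreover have "fst u * fst u + snd u * snd u > 0"
    using assms(3) by (auto simp: prod_eq_iff sum_squares_gt_zero_iff)
  moreover have "dot u u * fst v + - dot u v * fst u + 0 * fst u = 0"
    "dot u u * snd v + - dot u v * snd u + 0 * snd u = 0"
    using assms(5) by algebra+
  ultimately show False
    using no_zero_sum_three[OF assms(1) assms(4,2,2), of "dot u u" "- dot u v" 0] by simp
qed

text \<open>The clockwise-most step exists because of the relation
  \<open>cross v w * u + cross w u * v + cross u v * w = 0\<close>, whose coefficients are integers.\<close>

lemma extreme_step:
  assumes "\<not> IPP X" "step_set X" "finite Y" "Y \<noteq> {}" "Y \<subseteq> X"
  shows "\<exists>p\<in>Y. \<forall>x\<in>Y. 0 < cross p x \<or> (cross p x = 0 \<and> 0 < dot p x)"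
  using assms(3-)
proof (induction rule: finite_ne_induct)
  case (singleton v)
  then show ?case
    using no_opposite_steps[OF assms(1), of v v] assms(2) by (auto simp: step_set_def)
next
  case (insert v Y)
  then obtain p where p: "p \<in> Y" "\<And>x. x \<in> Y \<Longrightarrow> 0 < cross p x \<or> (cross p x = 0 \<and> 0 < dot p x)"
    by auto
  have pX: "p \<in> X" "v \<in> X" and nz: "p \<noteq> 0" "v \<noteq> 0"
    using insert.prems p(1) assms(2) by (auto simp: step_set_def)
  consider "cross p v > 0" | "cross p v = 0" | "cross p v < 0"
    by linarith
  then show ?case
  proof cases
    case 1
    then show ?thesis
      using p by (intro bexI[of _ p]) auto
  next
    case 2
    then show ?thesis
      using p no_opposite_steps[OF assms(1) pX(1) nz(1) pX(2)] by (intro bexI[of _ p]) auto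
  next
    case 3
    \<comment> \<open>\<open>v\<close> takes over as extreme step. If some \<open>x\<close> were
      clockwise of \<open>v\<close>, the relation among \<open>x\<close>, \<open>v\<close>,
      \<open>p\<close> would have nonnegative coefficients, with \<open>cross v p > 0\<close> at
      \<open>x\<close>.\<close>
    have "0 < cross v x \<or> (cross v x = 0 \<and> 0 < dot v x)" if "x \<in> insert v Y" for x
    proof (cases "cross v x < 0")
      case True
      then have x: "x \<in> Y"
        using that by (auto simp: mult.commute)
      then have "0 \<le> cross p x" "x \<in> X"
        using p(2)[OF x] insert.prems by auto
      moreover have "cross v p * fst x + cross p x * fst v + cross x v * fst p = 0"
        "cross v p * snd x + cross p x * snd v + cross x v * snd p = 0"
        by algebra+
      moreover have "0 < cross v p" "0 \<le> cross x v"
        using 3 True by (simp_all add: algebra_simps)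
      ultimately show ?thesis
        using no_zero_sum_three[OF assms(1) _ pX(2,1)] by blast
    next
      case False
      then show ?thesis
        using no_opposite_steps[OF assms(1) pX(2) nz(2), of x] that insert.prems by force
    qed
    then show ?thesis by blast
  qed
qed

lemma finite_not_IPP_imp_CC:
  assumes "step_set X" "finite X" "\<not> IPP X"
  shows "CC X"
proof (cases "X = {}")
  case True
  then show ?thesis
    unfolding CC_iff by (intro exI[of _ "(1, 0)"] exI[of _ "(0, 1)"]) auto
next
  case False
  then obtain p where p: "p \<in> X" "\<And>x. x \<in> X \<Longrightarrow> 0 < cross p x \<or> (cross p x = 0 \<and> 0 < dot p x)"
    using extreme_step[OF assms(3,1,2)] by blast
  have p0: "p \<noteq> 0"
    using p(1) assms(1) by (auto simp: step_set_def)
  define N where "N = (\<Sum>x\<in>X. \<bar>dot p x\<bar>) + 1"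
  have N: "\<bar>dot p x\<bar> < N" if "x \<in> X" for x
    using member_le_sum[of x X "\<lambda>x. \<bar>dot p x\<bar>"] that assms(2) by (simp add: N_def)
  \<comment> \<open>\<open>a n\<close> is \<open>p\<close> plus \<open>n\<close> times
    \<open>p\<close> rotated counterclockwise by a quarter turn.\<close>
  define a where "a n = (real_of_int (fst p - n * snd p), real_of_int (snd p + n * fst p))" for n
  have a: "a n \<bullet> to_plane x = of_int (n * cross p x + dot p x)" for n x
    by (simp add: a_def inner_to_plane algebra_simps)
  have pos: "0 < a n \<bullet> to_plane x" if x: "x \<in> X" and n: "N \<le> n" for n x
  proof -
    have "0 < n * cross p x + dot p x"
      using p(2)[OF x]
    proof
      assume "0 < cross p x"
      \<comment> \<open>A positive integer is at least \<open>1\<close>, so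
        \<open>n * cross p x\<close> outweighs \<open>dot p x\<close>.\<close>
      then have "n * 1 \<le> n * cross p x"
        using N[OF x] n by (intro mult_left_mono) auto
      then show ?thesis
        using N[OF x] n by linarith
    qed auto
    then show ?thesis
      unfolding a by (simp only: of_int_0_less_iff)
  qed
  \<comment> \<open>Passing to \<open>N + 1\<close> adds the rotated \<open>p\<close>, so the
    determinant is the squared length of \<open>p\<close>, whatever \<open>N\<close> is.\<close>
  have "fst (a N) * snd (a (N + 1)) - snd (a N) * fst (a (N + 1)) = of_int (dot p p)"
    by (simp add: a_def algebra_simps)
  moreover have "dot p p \<noteq> 0"
    using p0 by (auto simp: prod_eq_iff)
  ultimately have "fst (a N) * snd (a (N + 1)) \<noteq> snd (a N) * fst (a (N + 1))"
    by (metis eq_iff_diff_eq_0 of_int_eq_0_iff)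
  then show ?thesis
    unfolding CC_iff using pos[of _ N] pos[of _ "N + 1"] by force
qed

section \<open>Counterexamples\<close>

definition vertical_line_steps :: "point set" where
  "vertical_line_steps = {1} \<times> UNIV"

lemma SLC_vertical_line_steps: "SLC vertical_line_steps"
  unfolding SLC_iff
  by (intro exI[of _ "(1, 0)"] exI[of _ "1 / 2"])
     (auto simp: vertical_line_steps_def inner_to_plane zero_prod_def)

text \<open>A nonzero slope makes the affine function negative at a far enough integer of suitable
  sign.\<close>

lemma linear_positive_imp_const:
  fixes u v :: real
  assumes "\<And>y::int. 0 < u + v * of_int y"
  shows "v = 0"
proof (rule ccontr)
  assume v: "v \<noteq> 0"
  obtain n :: nat where n: "u < of_nat n * \<bar>v\<bar>"
    using v ex_less_of_nat_mult[of "\<bar>v\<bar>" u] by auto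
  show False
    using assms[of "int n"] assms[of "- int n"] n by (auto simp: abs_if algebra_simps split: if_splits)
qed

text \<open>Positivity on the whole line makes both normals horizontal, hence parallel.\<close>

lemma not_CC_vertical_line_steps: "\<not> CC vertical_line_steps"
proof
  assume "CC vertical_line_steps"
  then obtain a b where det: "fst a * snd b \<noteq> snd a * fst b"
    and *: "\<And>x. x \<in> vertical_line_steps \<Longrightarrow> 0 < a \<bullet> to_plane x \<and> 0 < b \<bullet> to_plane x"
    unfolding CC_iff by blast
  have "0 < fst a + snd a * of_int y \<and> 0 < fst b + snd b * of_int y" for y
    using *[of "(1, y)"] by (auto simp: vertical_line_steps_def inner_to_plane)
  then have "snd a = 0" "snd b = 0"
    using linear_positive_imp_const by blast+
  then show False
    using det by simp
qed

lemma not_FPP_vertical_line_steps: "\<not> FPP vertical_line_steps"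
proof
  assume FPP: "FPP vertical_line_steps"
  let ?f = "\<lambda>y::int. [(1, y), (1, - y)] :: point list"
  have "range ?f \<subseteq> paths vertical_line_steps (2, 0)"
    by (auto simp: paths_def vertical_line_steps_def zero_prod_def)
  moreover have "inj ?f"
    by (auto intro: injI)
  then have "infinite (range ?f)"
    using infinite_UNIV_int finite_imageD by blast
  ultimately have "infinite (paths vertical_line_steps (2, 0))"
    using finite_subset by blast
  moreover have "(2, 0) = sum_list (?f 0)"
    by (simp add: zero_prod_def)
  then have "(2, 0) \<in> submonoid_gen vertical_line_steps"
    unfolding submonoid_gen_eq by (rule image_eqI) (auto simp: vertical_line_steps_def)
  ultimately show False
    using FPP unfolding FPP_def path_count_less_top_iff by blast
qed

text \<open>The directions on the parabola approach that of \<open>(0, -1)\<close>, opposite to the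
  extra step \<open>(0, 1)\<close>; this defeats the LC, while only finitely many steps have a given
  bound on the abscissa.\<close>

definition parabola_steps :: "point set" where
  "parabola_steps = insert (0, 1) ((\<lambda>n. (n, - n\<^sup>2)) ` {1..})"

lemma step_set_parabola_steps: "step_set parabola_steps"
  by (auto simp: step_set_def parabola_steps_def zero_prod_def)

lemma not_LC_parabola_steps: "\<not> LC parabola_steps"
proof
  assume "LC parabola_steps"
  then obtain a where *: "\<And>x. x \<in> parabola_steps \<Longrightarrow> 0 < a \<bullet> to_plane x"
    unfolding LC_iff by blast
  have a2: "0 < snd a"
    using *[of "(0, 1)"] by (simp add: parabola_steps_def inner_to_plane)
  \<comment> \<open>At abscissa \<open>n + 1\<close> the quadratic term dominates; the shift keeps
    the abscissa at least \<open>1\<close>, as membership demands.\<close>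
  obtain n :: nat where n: "fst a < of_nat n * snd a"
    using ex_less_of_nat_mult[OF a2] by blast
  have "(int n + 1, - (int n + 1)\<^sup>2) \<in> parabola_steps"
    by (auto simp: parabola_steps_def)
  from *[OF this] have "0 < (fst a - snd a * (of_nat n + 1)) * (of_nat n + 1)"
    by (simp add: inner_to_plane algebra_simps power2_eq_square)
  then have "0 < fst a - snd a * (of_nat n + 1)"
    by (simp add: zero_less_mult_iff)
  then show False
    using n a2 by (simp add: algebra_simps)
qed

text \<open>A path to a point with abscissa \<open>m\<close> uses only steps with abscissa at most \<open>m\<close>, and on these
  the functional \<open>(m\<^sup>2 + 1) x + y\<close> is at least \<open>1\<close>.\<close>

lemma FPP_parabola_steps: "FPP parabola_steps"
  unfolding FPP_def path_count_less_top_iff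
proof
  fix A :: point
  let ?m = "fst A"
  let ?F = "insert (0, 1) ((\<lambda>n. (n, - n\<^sup>2)) ` {1..?m})"
  show "finite (paths parabola_steps A)"
  proof (rule finite_paths_if)
    show "set w \<subseteq> ?F" if w: "w \<in> paths parabola_steps A" for w
    proof
      fix x assume x: "x \<in> set w"
      have wX: "set w \<subseteq> parabola_steps" "sum_list w = A"
        using w by (auto simp: paths_def)
      have "0 \<le> (1, 0) \<bullet> to_plane y" if "y \<in> set w" for y
        using wX that by (auto simp: inner_to_plane parabola_steps_def)
      then have "(1, 0) \<bullet> to_plane x \<le> (1, 0) \<bullet> to_plane A"
        using inner_step_le_inner_sum_list[of w "(1, 0)" x] x wX by blast
      then have "fst x \<le> ?m"
        by (simp add: inner_to_plane)
      then show "x \<in> ?F"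
        using wX x by (auto simp: parabola_steps_def)
    qed
    show "1 \<le> (of_int (?m\<^sup>2 + 1), 1) \<bullet> to_plane x" if x: "x \<in> ?F \<inter> parabola_steps" for x
    proof -
      have "1 \<le> (?m\<^sup>2 + 1) * fst x + snd x"
      proof (cases "x = (0, 1)")
        case False
        then obtain n where n: "x = (n, - n\<^sup>2)" "1 \<le> n" "n \<le> ?m"
          using x by auto
        have "n\<^sup>2 \<le> ?m\<^sup>2"
          using n by (intro power_mono) auto
        moreover have "(?m\<^sup>2 + 1) * 1 \<le> (?m\<^sup>2 + 1) * n"
          using n by (intro mult_left_mono) auto
        ultimately show ?thesis
          by (simp add: n(1) algebra_simps)
      qed simp
      then have "real_of_int 1 \<le> of_int ((?m\<^sup>2 + 1) * fst x + snd x)"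
        by (simp only: of_int_le_iff)
      then show ?thesis
        by (simp add: inner_to_plane)
    qed
  qed auto
qed

definition irrational_half_plane_steps :: "point set" where
  "irrational_half_plane_steps = {x. 0 < (sqrt 2, 1) \<bullet> to_plane x}"

lemma step_set_irrational_half_plane_steps: "step_set irrational_half_plane_steps"
  by (simp add: step_set_def irrational_half_plane_steps_def inner_to_plane)

lemma LC_irrational_half_plane_steps: "LC irrational_half_plane_steps"
  unfolding LC_iff
  by (intro exI[of _ "(sqrt 2, 1)"]) (auto simp: irrational_half_plane_steps_def zero_prod_def)

text \<open>The values \<open>sqrt 2 * x + y\<close> at lattice points are closed under
  multiplication. As \<open>sqrt 2 - 1\<close> lies between \<open>0\<close> and \<open>1\<close>,
  its powers supply arbitrarily small positive values.\<close>

lemma power_sqrt2_minus_1: "\<exists>u. (sqrt 2, 1) \<bullet> to_plane u = (sqrt 2 - 1) ^ k"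
proof (induction k)
  case 0
  show ?case by (intro exI[of _ "(0, 1)"]) (simp add: inner_to_plane)
next
  case (Suc k)
  then obtain x y :: int where "sqrt 2 * of_int x + of_int y = (sqrt 2 - 1) ^ k"
    by (auto simp: inner_to_plane)
  then have "(sqrt 2 - 1) ^ Suc k = (sqrt 2 - 1) * (sqrt 2 * of_int x + of_int y)"
    by simp
  also have "\<dots> = (sqrt 2, 1) \<bullet> to_plane (y - x, 2 * x - y)"
    by (simp add: inner_to_plane algebra_simps)
  finally show ?case by metis
qed

text \<open>A step \<open>u\<close> with \<open>0 < \<surd>2 x + y < 1 / (n + 1)\<close> gives the path
  \<open>u, \<dots>, u, (0, 1) - n u\<close> of length \<open>n + 1\<close>.\<close>

lemma not_BPP_irrational_half_plane_steps: "\<not> BPP irrational_half_plane_steps" (is "\<not> BPP ?X")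
proof
  assume BPP: "BPP ?X"
  have "Suc n \<in> length ` paths ?X (0, 1)" for n
  proof -
    have "sqrt 2 - 1 < (1::real)"
      using real_sqrt_less_iff[of 2 4] by simp
    then obtain k where k: "(sqrt 2 - 1) ^ k < 1 / (of_nat n + 1)"
      using real_arch_pow_inv[of "1 / (of_nat n + 1)" "sqrt 2 - 1"] by auto
    obtain u where u: "(sqrt 2, 1) \<bullet> to_plane u = (sqrt 2 - 1) ^ k"
      using power_sqrt2_minus_1 by blast
    define h where "h = (sqrt 2, 1) \<bullet> to_plane u"
    have h: "0 < h" "(of_nat n + 1) * h < 1"
      using k u by (auto simp: h_def field_simps)
    define v where "v = (- int n * fst u, 1 - int n * snd u)"
    have "(sqrt 2, 1) \<bullet> to_plane v = 1 - of_nat n * h"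
      by (simp add: v_def h_def inner_to_plane algebra_simps)
    then have "v \<in> ?X" "u \<in> ?X"
      using h by (auto simp: irrational_half_plane_steps_def h_def algebra_simps)
    then have "replicate n u @ [v] \<in> paths ?X (0, 1)"
      by (auto simp: paths_def sum_list_replicate_point v_def prod_eq_iff)
    then show ?thesis
      by (intro image_eqI[of _ _ "replicate n u @ [v]"]) auto
  qed
  then have "Suc ` UNIV \<subseteq> length ` paths ?X (0, 1)"
    by auto
  moreover have "infinite (range Suc)"
    by (rule range_inj_infinite) simp
  ultimately have "infinite (length ` paths ?X (0, 1))"
    using finite_subset by blast
  moreover have "(0, 1) \<in> submonoid_gen ?X"
    by (intro submonoid_gen.gen) (simp add: irrational_half_plane_steps_def inner_to_plane)
  ultimately show False
    using BPP by (auto simp: BPP_def)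
qed

theorem theorem2p27:
  shows
    "(\<forall>X. step_set X \<longrightarrow>
        (CC X \<longrightarrow> SLC X) \<and> (SLC X \<longrightarrow> LC X) \<and> (FPP X \<longrightarrow> BPP X) \<and> (BPP X \<longrightarrow> \<not> IPP X) \<and>
        (CC X \<longrightarrow> FPP X) \<and> (SLC X \<longrightarrow> BPP X) \<and> (LC X \<longrightarrow> \<not> IPP X))
     \<and>
     (\<forall>X. step_set X \<longrightarrow> finite X \<longrightarrow>
        (CC X \<longleftrightarrow> SLC X) \<and> (SLC X \<longleftrightarrow> LC X) \<and> (FPP X \<longleftrightarrow> BPP X) \<and> (BPP X \<longleftrightarrow> \<not> IPP X) \<and>
        (CC X \<longleftrightarrow> FPP X) \<and> (SLC X \<longleftrightarrow> BPP X) \<and> (LC X \<longleftrightarrow> \<not> IPP X))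
     \<and>
     ((\<exists>X. step_set X \<and> SLC X \<and> \<not> CC X) \<and>
      (\<exists>X. step_set X \<and> LC X \<and> \<not> SLC X) \<and>
      (\<exists>X. step_set X \<and> BPP X \<and> \<not> FPP X) \<and>
      (\<exists>X. step_set X \<and> \<not> IPP X \<and> \<not> BPP X) \<and>
      (\<exists>X. step_set X \<and> FPP X \<and> \<not> CC X) \<and>
      (\<exists>X. step_set X \<and> BPP X \<and> \<not> SLC X) \<and>
      (\<exists>X. step_set X \<and> \<not> IPP X \<and> \<not> LC X))"
proof (intro conjI)
  show "\<forall>X. step_set X \<longrightarrow>
        (CC X \<longrightarrow> SLC X) \<and> (SLC X \<longrightarrow> LC X) \<and> (FPP X \<longrightarrow> BPP X) \<and> (BPP X \<longrightarrow> \<not> IPP X) \<and>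
        (CC X \<longrightarrow> FPP X) \<and> (SLC X \<longrightarrow> BPP X) \<and> (LC X \<longrightarrow> \<not> IPP X)"
    using CC_imp_SLC SLC_imp_LC FPP_imp_BPP BPP_imp_not_IPP CC_imp_FPP SLC_imp_BPP LC_imp_not_IPP
    by blast
  \<comment> \<open>For finite \<open>X\<close>, \<open>\<not> IPP\<close> leads back to CC and so
    closes both chains: CC, SLC, LC and CC, FPP, BPP.\<close>
  show "\<forall>X. step_set X \<longrightarrow> finite X \<longrightarrow>
        (CC X \<longleftrightarrow> SLC X) \<and> (SLC X \<longleftrightarrow> LC X) \<and> (FPP X \<longleftrightarrow> BPP X) \<and> (BPP X \<longleftrightarrow> \<not> IPP X) \<and>
        (CC X \<longleftrightarrow> FPP X) \<and> (SLC X \<longleftrightarrow> BPP X) \<and> (LC X \<longleftrightarrow> \<not> IPP X)"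
    using CC_imp_SLC SLC_imp_LC FPP_imp_BPP BPP_imp_not_IPP CC_imp_FPP LC_imp_not_IPP
      finite_not_IPP_imp_CC by metis
  have "step_set vertical_line_steps"
    by (auto simp: step_set_def vertical_line_steps_def zero_prod_def)
  then show "\<exists>X. step_set X \<and> SLC X \<and> \<not> CC X" "\<exists>X. step_set X \<and> BPP X \<and> \<not> FPP X"
    using SLC_vertical_line_steps not_CC_vertical_line_steps not_FPP_vertical_line_steps SLC_imp_BPP
    by blast+
  \<comment> \<open>The LC gives \<open>\<not> IPP\<close>, and the failing BPP excludes the
    SLC.\<close>
  show "\<exists>X. step_set X \<and> LC X \<and> \<not> SLC X" "\<exists>X. step_set X \<and> \<not> IPP X \<and> \<not> BPP X"
    using step_set_irrational_half_plane_steps LC_irrational_half_plane_steps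
      not_BPP_irrational_half_plane_steps SLC_imp_BPP LC_imp_not_IPP by blast+
  \<comment> \<open>The FPP passes down to the BPP and \<open>\<not> IPP\<close>, while the failing
    LC excludes the SLC and the CC.\<close>
  show "\<exists>X. step_set X \<and> FPP X \<and> \<not> CC X" "\<exists>X. step_set X \<and> BPP X \<and> \<not> SLC X"
    "\<exists>X. step_set X \<and> \<not> IPP X \<and> \<not> LC X"
    using step_set_parabola_steps FPP_parabola_steps not_LC_parabola_steps
      CC_imp_SLC SLC_imp_LC FPP_imp_BPP BPP_imp_not_IPP by blast+
qed

end
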